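(* Let $m, r \ge 1$ and let $\Lambda$ and $\beta$ be real $m \times r$ matrices, both having an ordered GLT structure, with pivot rows $l_1 < \ldots < l_r$ and $\tilde l_1 < \ldots < \tilde l_r$, respectively. If $\beta \beta^{\top} = \Lambda \Lambda^{\top}$, then $\beta = \Lambda$, and consequently $(\tilde l_1, \ldots, \tilde l_r) = (l_1, \ldots, l_r)$.
   Context: For a real $m \times r$ matrix $\Lambda = (\Lambda_{ij})$ with $r$ non-zero columns, the pivot row $l_j$ of column $j$ is the row index of the first non-zero entry in column $j$, i.e. $\Lambda_{ij} = 0$ for all $i < l_j$ and $\Lambda_{l_j, j} \neq 0$; the entry $\Lambda_{l_j,j}$ is the leading factor loading of column $j$. A real $m \times r$ matrix $\Lambda$ of full column rank $r$ has an ordered GLT (generalized lower triangular) structure if its pivot rows satisfy $l_1 < \ldots < l_r$ and its leading factor loadings are positive, $\Lambda_{l_j,j} > 0$ for $j = 1, \ldots, r$. *)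

theory Defs
  imports "Jordan_Normal_Form.DL_Rank"
begin

(* Rows and columns are indexed from 0. The value is meaningful only if column j is non-zero;
   this is automatic for the columns of a matrix of full column rank. *)
definition pivot_row :: "real mat \<Rightarrow> nat \<Rightarrow> nat" where
  "pivot_row \<Lambda> j = (LEAST i. i < dim_row \<Lambda> \<and> \<Lambda> $$ (i, j) \<noteq> 0)"

definition leading_factor_loading :: "real mat \<Rightarrow> nat \<Rightarrow> real" where
  "leading_factor_loading \<Lambda> j = \<Lambda> $$ (pivot_row \<Lambda> j, j)"

definition ordered_GLT :: "real mat \<Rightarrow> bool" where
  "ordered_GLT \<Lambda> \<longleftrightarrow>
     vec_space.rank (dim_row \<Lambda>) \<Lambda> = dim_col \<Lambda> \<and>
     strict_mono_on {..<dim_col \<Lambda>} (pivot_row \<Lambda>) \<and>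
     (\<forall>j < dim_col \<Lambda>. leading_factor_loading \<Lambda> j > 0)"

end

theory Submission
  imports Defs
begin

(* By induction on j, the first j columns agree and cancel from the two Gram matrices. In what
   remains, all columns but the j-th vanish down to and including row p, where p is the pivot row
   of column j in either matrix: a zero diagonal entry of the Gram matrix forces the row to vanish,
   so the two pivot rows coincide. Row p of the Gram matrix then determines column j up to the sign
   of its leading entry, which is positive. *)

text \<open>A maximal independent set of columns has \<open>rank A = nc\<close> elements. As there
  are at most \<open>nc\<close> distinct columns, it contains them all, and an independent set
  avoids the zero vector.\<close>

lemma (in vec_space) full_rank_col_nonzero:
  assumes A: "A \<in> carrier_mat n nc" and "rank A = nc" and "j < nc"
  shows "col A j \<noteq> 0\<^sub>v n"
proof -
  obtain S where S: "maximal S (\<lambda>T. T \<subseteq> set (cols A) \<and> lin_indpt T)"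
    using maximal_exists[of "(\<lambda>T. T \<subseteq> set (cols A) \<and> lin_indpt T)" "card (set (cols A))" "{}"]
    by (meson List.finite_set card_mono empty_iff empty_subsetI finite_lin_indpt2 rev_finite_subset)
  then have sub: "S \<subseteq> set (cols A)" and li: "lin_indpt S"
    by (auto simp: maximal_def)
  have "card (set (cols A)) \<le> card S"
    using rank_card_indpt[OF A S] assms card_length[of "cols A"] by simp
  then have "S = set (cols A)"
    using sub by (simp add: card_seteq)
  moreover have "col A j \<in> set (cols A)"
    using assms by (auto simp: cols_def)
  moreover have "S \<subseteq> carrier_vec n"
    using sub cols_dim[of A] A by auto
  \<comment> \<open>Over the zero ring an independent set could contain the zero vector, so a
    non-zero scalar is needed.\<close>
  moreover have "(UNIV :: 'a set) \<noteq> {0}"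
    using one_neq_zero by blast
  ultimately show ?thesis
    using zero_nin_lin_indpt[OF _ li] by auto
qed

text \<open>Full rank enters the proof only here: it supplies a non-zero entry in column
  \<open>j\<close>, without which the \<open>LEAST\<close> in \<open>pivot_row\<close> would say
  nothing.\<close>

lemma ordered_GLT_pivot:
  assumes "\<Lambda> \<in> carrier_mat m r" and "ordered_GLT \<Lambda>" and "j < r"
  shows pivot_row_less: "pivot_row \<Lambda> j < m"
    and pivot_entry_pos: "\<Lambda> $$ (pivot_row \<Lambda> j, j) > 0"
proof -
  have "\<exists>i < m. \<Lambda> $$ (i, j) \<noteq> 0"
  proof (rule ccontr)
    assume "\<not> ?thesis"
    then have "col \<Lambda> j = 0\<^sub>v m"
      using assms by (intro eq_vecI) auto
    then show False
      using vec_space.full_rank_col_nonzero[of \<Lambda> m r j] assms by (auto simp: ordered_GLT_def)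
  qed
  then have "\<exists>i. i < dim_row \<Lambda> \<and> \<Lambda> $$ (i, j) \<noteq> 0"
    using assms by auto
  from LeastI_ex[OF this] show "pivot_row \<Lambda> j < m"
    using assms by (auto simp: pivot_row_def)
  show "\<Lambda> $$ (pivot_row \<Lambda> j, j) > 0"
    using assms by (auto simp: ordered_GLT_def leading_factor_loading_def)
qed

lemma entry_above_pivot:
  assumes "i < pivot_row \<Lambda> j" and "i < dim_row \<Lambda>"
  shows "\<Lambda> $$ (i, j) = 0"
  using assms not_less_Least unfolding pivot_row_def by blast

text \<open>Pivots strictly descend from column to column, so row \<open>i\<close> lies strictly
  above the pivot of every later column \<open>k\<close>.\<close>

lemma ordered_GLT_entry_zero:
  assumes "\<Lambda> \<in> carrier_mat m r" and "ordered_GLT \<Lambda>"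
    and "i \<le> pivot_row \<Lambda> j" and "j < k" and "k < r"
  shows "\<Lambda> $$ (i, k) = 0"
proof -
  have "pivot_row \<Lambda> j < pivot_row \<Lambda> k"
    using assms by (auto simp: ordered_GLT_def strict_mono_on_def)
  moreover have "pivot_row \<Lambda> k < m"
    using assms pivot_row_less by blast
  ultimately show ?thesis
    using assms by (intro entry_above_pivot) auto
qed

lemma mult_transpose_entry:
  assumes "A \<in> carrier_mat m r" and "i < m" and "i' < m"
  shows "(A * transpose_mat A) $$ (i, i') = (\<Sum>k<r. A $$ (i, k) * A $$ (i', k))"
  using assms by (auto simp: scalar_prod_def atLeast0LessThan)

lemma sum_lessThan_split_at:
  fixes f :: "nat \<Rightarrow> 'a::comm_monoid_add"
  assumes "j < r"
  shows "(\<Sum>k<r. f k) = (\<Sum>k<j. f k) + (\<Sum>k=j..<r. f k)"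
  using assms by (simp add: sum.atLeastLessThan_concat flip: atLeast0LessThan)

text \<open>The factor from row \<open>i\<close> kills every term after the \<open>j\<close>-th, so
  \<open>i'\<close> may be arbitrary. This is what later lets row \<open>p\<close> reach all entries
  of column \<open>j\<close>.\<close>

lemma sum_tail_pivot_row:
  assumes "\<Lambda> \<in> carrier_mat m r" and "ordered_GLT \<Lambda>" and "j < r" and "i \<le> pivot_row \<Lambda> j"
  shows "(\<Sum>k=j..<r. \<Lambda> $$ (i, k) * \<Lambda> $$ (i', k)) = \<Lambda> $$ (i, j) * \<Lambda> $$ (i', j)"
proof -
  have "(\<Sum>k=Suc j..<r. \<Lambda> $$ (i, k) * \<Lambda> $$ (i', k)) = 0"
    using assms by (intro sum.neutral) (auto simp: ordered_GLT_entry_zero Suc_le_eq)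
  then show ?thesis
    using assms by (simp add: sum.atLeast_Suc_lessThan)
qed

text \<open>One inequality suffices, since the hypotheses are symmetric and the lemma can be used
  again with \<open>A\<close> and \<open>B\<close> exchanged. Only diagonal entries of the Gram
  matrices are compared.\<close>

lemma pivot_row_le:
  assumes A: "A \<in> carrier_mat m r" "ordered_GLT A" and B: "B \<in> carrier_mat m r" "ordered_GLT B"
    and j: "j < r"
    and gram: "\<And>i. i < m \<Longrightarrow>
      (\<Sum>k=j..<r. B $$ (i, k) * B $$ (i, k)) = (\<Sum>k=j..<r. A $$ (i, k) * A $$ (i, k))"
  shows "pivot_row A j \<le> pivot_row B j"
proof (rule ccontr)
  let ?q = "pivot_row B j"
  assume "\<not> ?thesis"
  then have less: "?q < pivot_row A j" by simp
  have q: "?q < m" and pos: "B $$ (?q, j) > 0"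
    using ordered_GLT_pivot[OF B j] by auto
  \<comment> \<open>Row \<open>?q\<close> lies at or above both pivots, so each tail sum reduces to
    one square.\<close>
  have "B $$ (?q, j) * B $$ (?q, j) = A $$ (?q, j) * A $$ (?q, j)"
    using gram[OF q] sum_tail_pivot_row[OF A j less_imp_le[OF less]]
      sum_tail_pivot_row[OF B j order_refl] by simp
  also have "A $$ (?q, j) = 0"
    using less q A by (intro entry_above_pivot) auto
  finally show False using pos by simp
qed

theorem theorem1:
  fixes m r :: nat and \<Lambda> \<beta> :: "real mat"
  assumes "m \<ge> 1" and "r \<ge> 1"
    and "\<Lambda> \<in> carrier_mat m r" and "\<beta> \<in> carrier_mat m r"
    and "ordered_GLT \<Lambda>" and "ordered_GLT \<beta>"
    and "\<beta> * transpose_mat \<beta> = \<Lambda> * transpose_mat \<Lambda>"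
  shows "\<beta> = \<Lambda> \<and> (\<forall>j < r. pivot_row \<beta> j = pivot_row \<Lambda> j)"
proof -
  note L = assms(3,5) and B = assms(4,6)
  have columns: "\<forall>i<m. \<beta> $$ (i, j) = \<Lambda> $$ (i, j)" if "j < r" for j
    using that
  proof (induction j rule: less_induct)
    case (less j)
    note j = \<open>j < r\<close>
    \<comment> \<open>The columns before \<open>j\<close> agree by induction and contribute equally
      to each Gram entry.\<close>
    have tail: "(\<Sum>k=j..<r. \<beta> $$ (i, k) * \<beta> $$ (i', k)) =
        (\<Sum>k=j..<r. \<Lambda> $$ (i, k) * \<Lambda> $$ (i', k))" if "i < m" "i' < m" for i i'
    proof -
      have "(\<Sum>k<r. \<beta> $$ (i, k) * \<beta> $$ (i', k)) = (\<Sum>k<r. \<Lambda> $$ (i, k) * \<Lambda> $$ (i', k))"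
        using mult_transpose_entry[OF L(1) that] mult_transpose_entry[OF B(1) that] assms(7) by simp
      moreover have "(\<Sum>k<j. \<beta> $$ (i, k) * \<beta> $$ (i', k)) = (\<Sum>k<j. \<Lambda> $$ (i, k) * \<Lambda> $$ (i', k))"
        using less j that by (intro sum.cong) auto
      ultimately show ?thesis
        by (simp add: sum_lessThan_split_at[OF j])
    qed
    define p where "p = pivot_row \<Lambda> j"
    have pB: "p = pivot_row \<beta> j"
      unfolding p_def by (intro antisym pivot_row_le[OF L B j] pivot_row_le[OF B L j]) (simp_all add: tail)
    have p: "p < m" and posL: "\<Lambda> $$ (p, j) > 0" and posB: "\<beta> $$ (p, j) > 0"
      using ordered_GLT_pivot[OF L j] ordered_GLT_pivot[OF B j] pB by (auto simp: p_def)
    have row: "\<beta> $$ (p, j) * \<beta> $$ (i, j) = \<Lambda> $$ (p, j) * \<Lambda> $$ (i, j)" if "i < m" for i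
      using tail[OF p that] sum_tail_pivot_row[OF L j, of p i] sum_tail_pivot_row[OF B j, of p i] pB
      by (simp add: p_def)
    \<comment> \<open>Taking \<open>i = p\<close> in \<open>row\<close> gives equal squares, and
      positivity rules out opposite signs. The common factor then cancels from \<open>row\<close>
      for every \<open>i\<close>.\<close>
    have "\<beta> $$ (p, j) = \<Lambda> $$ (p, j)"
      using row[OF p] posL posB by (auto simp: square_eq_iff)
    then show ?case
      using row posL by auto
  qed
  have "\<beta> = \<Lambda>"
    using L B columns by (intro eq_matI) auto
  then show ?thesis by simp
qed

end
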